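(* There is an absolute constant $C>0$ such that for every integer $m\ge1$ the following holds. Let $A_m$ be the $2^m\times 2^m$ zero-one matrix indexed by $\{0,1\}^m$ with $(A_m)_{u,v}=1$ if and only if $u$ and $v$ have disjoint supports (this is the adjacency matrix of the graph $\Gamma_m$ on $\{0,1\}^m$ in which two vectors are adjacent iff their supports are disjoint; the zero vector carries a loop). Then $$\|A_m\|_{\Delta}\le C\,\frac{\|A_m\|}{m^{1/4}}\quad\text{and}\quad \|A_m\|_P\le C\,\frac{\|A_m\|}{\sqrt m}.$$
   Context: $\|A\|$ is the operator norm induced by the Euclidean norm. For a complex $N\times N$ matrix $A$: $\|A\|_{\Delta}:=\max_{0\ne\xi\in\{0,1\}^N}\|A\xi\|/\|\xi\|$ and $\|A\|_P:=\max\frac{|\xi^tA\eta|}{\|\xi\|\|\eta\|}$ over all non-zero $\xi,\eta\in\{0,1\}^N$, with $\|\cdot\|$ the Euclidean norm. *)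

theory Defs
  imports "HOL-Analysis.Analysis"
begin

text \<open>
  A complex square matrix with finite, nonempty index set \<open>I\<close> is a function
  \<open>A :: 'i \<Rightarrow> 'i \<Rightarrow> complex\<close> of which only the values on \<open>I\<close> matter, and likewise for vectors
  \<open>'i \<Rightarrow> complex\<close>. (A set is used instead of an index type so that the size of the matrix
  can be quantified over inside a formula.)
\<close>

definition euclid_norm :: "'i set \<Rightarrow> ('i \<Rightarrow> complex) \<Rightarrow> real" where
  "euclid_norm I x = L2_set (\<lambda>i. norm (x i)) I"

definition mat_vec :: "'i set \<Rightarrow> ('i \<Rightarrow> 'i \<Rightarrow> complex) \<Rightarrow> ('i \<Rightarrow> complex) \<Rightarrow> 'i \<Rightarrow> complex" where
  "mat_vec I A x = (\<lambda>i. \<Sum>j\<in>I. A i j * x j)"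

definition op_norm :: "'i set \<Rightarrow> ('i \<Rightarrow> 'i \<Rightarrow> complex) \<Rightarrow> real" where
  "op_norm I A =
     (SUP x\<in>{x. \<exists>i\<in>I. x i \<noteq> 0}. euclid_norm I (mat_vec I A x) / euclid_norm I x)"

text \<open>The extensional function space makes this set finite, so that \<open>Max\<close> is meaningful below.\<close>

definition nonzero_01_vecs :: "'i set \<Rightarrow> ('i \<Rightarrow> complex) set" where
  "nonzero_01_vecs I = {\<xi> \<in> I \<rightarrow>\<^sub>E {0, 1}. \<exists>i\<in>I. \<xi> i \<noteq> 0}"

definition Delta_norm :: "'i set \<Rightarrow> ('i \<Rightarrow> 'i \<Rightarrow> complex) \<Rightarrow> real" where
  "Delta_norm I A =
     Max ((\<lambda>\<xi>. euclid_norm I (mat_vec I A \<xi>) / euclid_norm I \<xi>) ` nonzero_01_vecs I)"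

definition P_norm :: "'i set \<Rightarrow> ('i \<Rightarrow> 'i \<Rightarrow> complex) \<Rightarrow> real" where
  "P_norm I A =
     Max ((\<lambda>(\<xi>, \<eta>). norm (\<Sum>i\<in>I. \<xi> i * mat_vec I A \<eta> i) / (euclid_norm I \<xi> * euclid_norm I \<eta>))
            ` (nonzero_01_vecs I \<times> nonzero_01_vecs I))"

definition cube :: "nat \<Rightarrow> (nat \<Rightarrow> nat) set" where
  "cube m = {..<m} \<rightarrow>\<^sub>E {0, 1}"

definition supp :: "nat \<Rightarrow> (nat \<Rightarrow> nat) \<Rightarrow> nat set" where
  "supp m u = {k. k < m \<and> u k \<noteq> 0}"

definition disj_mat :: "nat \<Rightarrow> (nat \<Rightarrow> nat) \<Rightarrow> (nat \<Rightarrow> nat) \<Rightarrow> complex" where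
  "disj_mat m u v = (if supp m u \<inter> supp m v = {} then 1 else 0)"

end

theory Submission
  imports Defs
begin

text \<open>
  Let \<open>\<phi>\<close> be the golden ratio and \<open>|u|\<close> the weight of \<open>u\<close>. The vector \<open>\<phi>^(-|u|)\<close> is an eigenvector
  of \<open>A\<^sub>m\<close> with eigenvalue \<open>\<phi>^m\<close>, so the operator norm is at least \<open>\<phi>^m\<close>. The binomial bound
  \<open>(n choose j) \<le> 2 \<phi>^(n+j) / \<surd>(n+1)\<close> shows that, unless \<open>|u|\<close> exceeds \<open>2m/3\<close>, at most
  \<open>O(\<phi>^m \<tau> / \<surd>m)\<close> vectors \<open>v\<close> disjoint from \<open>u\<close> satisfy \<open>\<phi>^|v| \<le> \<tau> \<phi>^|u|\<close>. Charging every
  edge between \<open>S\<close> and \<open>T\<close> to one of its ends by this criterion, with \<open>\<tau>\<^sup>2 = |T| / |S|\<close>, gives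
  \<open>O(\<phi>^m \<surd>(|S| |T|) / \<surd>m)\<close> edges, which is the bound on the P-norm. The same argument with \<open>\<tau> = 1\<close>
  for the entries of \<open>A\<^sub>m\<^sup>2\<close> bounds \<open>\<parallel>A\<^sub>m 1\<^sub>S\<parallel>\<^sup>2\<close>. Vectors of weight above \<open>2m/3\<close> have at most
  \<open>2^(m/3)\<close> neighbours and contribute an exponentially smaller amount because \<open>4 < \<phi>^3\<close>.
\<close>

section \<open>The golden ratio\<close>

definition gold :: real where "gold = (1 + sqrt 5) / 2"

lemma gold_sq: "gold\<^sup>2 = gold + 1"
  by (simp add: gold_def power2_eq_square field_simps)

text \<open>Rational bounds precise enough for the two numerical facts below: the lower one yields
  \<open>4 < gold ^ 3\<close>, the upper one \<open>gold\<^sup>2 \<le> 3\<close>.\<close>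

lemma gold_bounds: "8/5 < gold" "gold < 17/10"
proof -
  have "sqrt 5 > 11/5" by (rule real_less_rsqrt) (simp add: power2_eq_square)
  then show "8/5 < gold" by (simp add: gold_def)
  have "sqrt 5 < 12/5" by (rule real_less_lsqrt) (simp_all add: power2_eq_square)
  then show "gold < 17/10" by (simp add: gold_def)
qed

lemma gold_pos [simp]: "gold > 0" "gold \<noteq> 0" "gold \<ge> 0"
  using gold_bounds by auto

lemma inverse_gold: "1 / gold = gold - 1"
  using gold_sq gold_pos by (simp add: field_simps power2_eq_square)

lemma gold_ge_1: "gold \<ge> 1"
  using gold_bounds by simp

lemma gold_sq_le: "gold\<^sup>2 \<le> 3"
  using gold_sq gold_bounds by simp

text \<open>The Fibonacci recurrence \<open>gold ^ (n + 3) = gold ^ (n + 2) + gold ^ (n + 1)\<close>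
  absorbs each new term.\<close>

lemma sum_gold_powers_le: "(\<Sum>j\<le>n. gold ^ j) \<le> gold ^ (n + 2)"
proof (induction n)
  case 0
  then show ?case using one_le_power[OF gold_ge_1, of 2] by (simp add: power2_eq_square)
next
  case (Suc n)
  have "gold ^ (Suc n + 2) = gold ^ Suc n * (gold + 1)"
    by (simp only: power_add gold_sq)
  also have "\<dots> = gold ^ (n + 2) + gold ^ Suc n"
    by (simp add: algebra_simps)
  finally show ?case using Suc by simp
qed

text \<open>A geometric sum is within the factor \<open>gold\<^sup>2\<close> of its largest term,
  and every term kept is at most \<open>y\<close>. This will sum the binomial bound over all weights
  below a threshold.\<close>

lemma sum_gold_powers_below_le:
  assumes "y \<ge> 0"
  shows "(\<Sum>j\<le>n. if gold ^ j \<le> y then gold ^ j else 0) \<le> gold\<^sup>2 * y"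
proof (induction n)
  case 0
  have "1 * y \<le> gold\<^sup>2 * y"
    using assms one_le_power[OF gold_ge_1, of 2] by (rule mult_right_mono[rotated])
  moreover have "(\<Sum>j\<le>0. if gold ^ j \<le> y then gold ^ j else 0) = (if 1 \<le> y then 1 else 0)"
    by simp
  ultimately show ?case using assms by (simp split: if_splits)
next
  case (Suc n)
  show ?case
  proof (cases "gold ^ Suc n \<le> y")
    case True
    have "(\<Sum>j\<le>Suc n. if gold ^ j \<le> y then gold ^ j else 0) \<le> (\<Sum>j\<le>Suc n. gold ^ j)"
      by (intro sum_mono) simp
    also have "\<dots> \<le> gold\<^sup>2 * gold ^ Suc n"
      using sum_gold_powers_le[of "Suc n"] by (simp only: power_add mult.commute)
    also have "\<dots> \<le> gold\<^sup>2 * y" using True by (intro mult_left_mono) auto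
    finally show ?thesis .
  qed (use Suc in auto)
qed

section \<open>Binomial coefficients\<close>

text \<open>Consecutive central coefficients have ratio 2(2n+1)/(n+1), so the induction step reduces
  to (2n+1)(2n+3) \<le> 4(n+1)^2.\<close>

lemma central_binomial_upper_bound: "((2*n) choose n)\<^sup>2 * (2*n+1) \<le> 16 ^ n"
proof (induction n)
  case (Suc n)
  let ?c = "real ((2*n) choose n)" and ?d = "real ((2 * Suc n) choose Suc n)"
  have "Suc n * ((2 * Suc n) choose Suc n) = (2*n+2) * ((2*n+1) choose n)"
    using Suc_times_binomial_eq[of "2*n+1" n] by simp
  then have "Suc n * Suc n * ((2 * Suc n) choose Suc n)
      = (2*n+2) * (Suc n * (Suc (2*n) choose n))"
    by (metis mult.assoc mult.left_commute Suc_eq_plus1)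
  also have "Suc n * (Suc (2*n) choose n) = Suc n * (Suc (2*n) choose Suc n)"
    using binomial_symmetric[of n "Suc (2*n)"] by (simp add: Suc_diff_le)
  also have "\<dots> = (2*n+1) * ((2*n) choose n)"
    using Suc_times_binomial_eq[of "2*n" n] by simp
  finally have "real (Suc n * Suc n * ((2 * Suc n) choose Suc n))
      = real ((2*n+2) * ((2*n+1) * ((2*n) choose n)))" by (rule arg_cong)
  then have "real (Suc n) * real (Suc n) * ?d = real (2*n+2) * (real (2*n+1) * ?c)"
    unfolding of_nat_mult .
  moreover have "real (2*n+2) = 2 * real (Suc n)" by simp
  ultimately have "real (Suc n) * (real (Suc n) * ?d) = real (Suc n) * (2 * real (2*n+1) * ?c)"
    by (simp only: mult_ac)
  then have eq: "real (n+1) * ?d = 2 * real (2*n+1) * ?c"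
    unfolding mult_cancel_left by simp
  have "real (((2*n) choose n)\<^sup>2 * (2*n+1)) \<le> real (16 ^ n)"
    using Suc by (simp only: of_nat_le_iff)
  then have IH: "?c\<^sup>2 * real (2*n+1) \<le> 16 ^ n"
    by (simp only: of_nat_mult of_nat_power of_nat_numeral)
  have odd_eq: "real (2 * Suc n + 1) = real (2*n+3)" by simp
  have "(real (n+1))\<^sup>2 * (?d\<^sup>2 * real (2 * Suc n + 1))
      = (real (n+1) * ?d)\<^sup>2 * real (2*n+3)"
    unfolding odd_eq power_mult_distrib by (simp only: mult_ac)
  also have "\<dots> = (4 * real (2*n+1) * real (2*n+3)) * (?c\<^sup>2 * real (2*n+1))"
    using eq by algebra
  also have "\<dots> \<le> (4 * real (2*n+1) * real (2*n+3)) * 16 ^ n"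
    using IH by (rule mult_left_mono) simp
  also have "\<dots> \<le> (16 * (real (n+1))\<^sup>2) * 16 ^ n"
    by (intro mult_right_mono) (simp_all add: power2_eq_square algebra_simps)
  finally have "(real (n+1))\<^sup>2 * (?d\<^sup>2 * real (2 * Suc n + 1)) \<le> (real (n+1))\<^sup>2 * 16 ^ Suc n"
    by simp
  then have "?d\<^sup>2 * real (2 * Suc n + 1) \<le> 16 ^ Suc n"
    by (rule mult_left_le_imp_le) simp
  then have "real (((2 * Suc n) choose Suc n)\<^sup>2 * (2 * Suc n + 1)) \<le> real (16 ^ Suc n)"
    by (simp only: of_nat_mult of_nat_power of_nat_numeral)
  then show ?case by (simp only: of_nat_le_iff)
qed simp

text \<open>A middle coefficient is the largest in its row. For n = 2r+1 it is half of the central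
  coefficient of row 2r+2, so the central bound covers both parities.\<close>

lemma binomial_le_two_power: "real (n choose k) \<le> 2 ^ n / sqrt (real (n + 1))"
proof -
  have "(n choose k)\<^sup>2 * (n+1) \<le> 4 ^ n"
  proof (cases "even n")
    case True
    then obtain r where n: "n = 2*r" by (auto elim: evenE)
    have "(n choose k)\<^sup>2 * (n+1) \<le> ((2*r) choose r)\<^sup>2 * (2*r+1)"
      unfolding n using binomial_maximum'[of r k] by (intro mult_right_mono power_mono) auto
    also have "\<dots> \<le> 4 ^ n"
      using central_binomial_upper_bound[of r] by (simp add: n power_mult)
    finally show ?thesis .
  next
    case False
    then obtain r where n: "n = 2*r+1" by (auto elim: oddE)
    have 1: "n choose k \<le> Suc (2*r) choose r"
      using binomial_maximum[of n k] by (simp add: n)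
    have "(2 * Suc r) choose Suc r = (Suc (2*r) choose r) + (Suc (2*r) choose Suc r)"
      by simp
    also have "Suc (2*r) choose Suc r = Suc (2*r) choose r"
      using binomial_symmetric[of r "Suc (2*r)"] by (simp add: Suc_diff_le)
    finally have 2: "(2 * Suc r) choose Suc r = 2 * (Suc (2*r) choose r)" by simp
    have "4 * ((n choose k)\<^sup>2 * (n+1)) \<le> 4 * ((Suc (2*r) choose r)\<^sup>2 * (2 * Suc r + 1))"
      using 1 by (intro mult_mono power_mono) (auto simp: n)
    also have "\<dots> \<le> 4 * 4 ^ n"
      using central_binomial_upper_bound[of "Suc r"] unfolding 2
      by (simp add: n power_mult power_mult_distrib)
    finally show ?thesis by simp
  qed
  then have "real ((n choose k)\<^sup>2 * (n+1)) \<le> real (4 ^ n)" by (simp only: of_nat_le_iff)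
  moreover have "real (4 ^ n) = (2 ^ n)\<^sup>2"
    by (simp add: power2_eq_square flip: power_mult_distrib)
  ultimately have "(real (n choose k) * sqrt (real (n+1)))\<^sup>2 \<le> (2 ^ n)\<^sup>2"
    by (simp add: power_mult_distrib algebra_simps)
  then have "real (n choose k) * sqrt (real (n+1)) \<le> 2 ^ n"
    by (rule power2_le_imp_le) simp
  then show ?thesis by (simp add: field_simps)
qed

text \<open>Since C(n,k) C(k,j) = C(n,j) C(n-j,k-j), shifting k by j leaves the binomial expansion
  of (c+d)^(n-j). Writing c^k as (2c)^k / 2^k exhibits a symmetric binomial law with a binomially
  distributed number of trials.\<close>

lemma binomial_thinning:
  fixes c d :: real
  assumes "j \<le> n"
  shows "(\<Sum>k\<le>n. real (n choose k) * real (k choose j) * c ^ k * d ^ (n - k))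
      = real (n choose j) * c ^ j * (c + d) ^ (n - j)"
proof -
  have "(\<Sum>k\<le>n. real (n choose k) * real (k choose j) * c ^ k * d ^ (n - k))
      = (\<Sum>k\<in>{j..n}. real (n choose k) * real (k choose j) * c ^ k * d ^ (n - k))"
    by (rule sum.mono_neutral_right) (auto simp: binomial_eq_0)
  also have "\<dots> = (\<Sum>k\<in>{j..n}. real (n choose j) * real ((n-j) choose (k-j)) * c ^ k * d ^ (n - k))"
    by (intro sum.cong refl) (auto simp: choose_mult simp flip: of_nat_mult)
  also have "\<dots> = (\<Sum>i\<le>n-j. real (n choose j) * real ((n-j) choose i) * c ^ (i+j) * d ^ (n - (i+j)))"
    using assms by (intro sum.reindex_bij_witness[of _ "\<lambda>i. i + j" "\<lambda>k. k - j"]) auto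
  also have "\<dots> = real (n choose j) * c ^ j * (c + d) ^ (n - j)"
    unfolding binomial_ring sum_distrib_left
    by (intro sum.cong refl) (auto simp: power_add mult_ac add.commute)
  finally show ?thesis .
qed

text \<open>The absorption identity C(n,k)/(k+1) = C(n+1,k+1)/(n+1) turns the sum into the expansion
  of (a+b)^(n+1) without its constant term in a. Up to normalisation this bounds the mean of 1/(k+1)
  under a binomial law.\<close>

lemma sum_binomial_divide_Suc_le:
  fixes a b :: real
  assumes "a > 0" "b \<ge> 0"
  shows "(\<Sum>k\<le>n. real (n choose k) * a ^ k * b ^ (n - k) / real (k + 1))
    \<le> (a + b) ^ (n + 1) / (a * real (n + 1))"
proof -
  have eq: "real (n choose k) / real (k+1) = real (Suc n choose Suc k) / real (n+1)" for k
  proof -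
    have "real (Suc k * (Suc n choose Suc k)) = real (Suc n * (n choose k))"
      by (simp only: Suc_times_binomial_eq mult.commute)
    then show ?thesis by (simp add: field_simps del: binomial_Suc_Suc)
  qed
  have "(\<Sum>k\<le>n. real (n choose k) * a ^ k * b ^ (n - k) / real (k + 1))
     = (\<Sum>k\<le>n. real (Suc n choose Suc k) * a ^ Suc k * b ^ (Suc n - Suc k)) / (a * real (n+1))"
    unfolding sum_divide_distrib
  proof (intro sum.cong refl)
    fix k
    have "real (n choose k) * a ^ k * b ^ (n - k) / real (k + 1)
        = real (n choose k) / real (k + 1) * (a ^ k * b ^ (n - k))" by simp
    also have "\<dots> = real (Suc n choose Suc k) / real (n + 1) * (a ^ k * b ^ (n - k))"
      using eq by (rule arg_cong)
    also have "\<dots> = real (Suc n choose Suc k) * a ^ Suc k * b ^ (Suc n - Suc k) / (a * real (n+1))"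
      using assms by (simp del: binomial_Suc_Suc)
    finally show "real (n choose k) * a ^ k * b ^ (n - k) / real (k + 1)
        = real (Suc n choose Suc k) * a ^ Suc k * b ^ (Suc n - Suc k) / (a * real (n+1))" .
  qed
  also have "(\<Sum>k\<le>n. real (Suc n choose Suc k) * a ^ Suc k * b ^ (Suc n - Suc k))
     \<le> (\<Sum>k\<le>Suc n. real (Suc n choose k) * a ^ k * b ^ (Suc n - k))"
    unfolding sum.atMost_Suc_shift[of _ n] using assms by simp
  also have "\<dots> = (a + b) ^ (n+1)" unfolding binomial_ring by simp
  finally show ?thesis using assms by (simp add: divide_right_mono)
qed

text \<open>A binomial distribution with success probability \<open>p \<le> 1/2\<close> is a symmetric one whose number
  of trials is itself binomial with success probability \<open>2p\<close>; this reduces the bound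
  \<open>O(1/\<surd>n)\<close> on its probabilities to the symmetric case. Here \<open>p = gold\<^sup>-\<^sup>2\<close>.\<close>

lemma binomial_le_gold_power:
  "real (n choose j) \<le> 2 * gold ^ (n + j) / sqrt (real (n + 1))"
proof (cases "j \<le> n")
  case False
  then show ?thesis by (simp add: binomial_eq_0)
next
  case True
  \<comment> \<open>With c + d = 1 the thinning identity leaves just C(n,j) c^j, and 2c + d = 1 +
    1/\<open>gold\<close> = \<open>gold\<close> makes the total mass of \<open>w\<close> equal to
    \<open>gold ^ n\<close>.\<close>
  define c d where "c = 1 / gold" and "d = 1 - c"
  define w where "w k = real (n choose k) * (2 * c) ^ k * d ^ (n - k)" for k
  have c: "c > 0" by (simp add: c_def)
  have d: "d \<ge> 0" using gold_ge_1 by (simp add: d_def c_def)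
  have cd: "2 * c + d = gold" using inverse_gold by (simp add: d_def c_def)
  have w0: "w k \<ge> 0" for k using c d by (simp add: w_def)
  let ?s = "sqrt (real (n+1))"
  have s: "?s > 0" by simp
  have ss: "?s * ?s = real (n+1)" by simp
  \<comment> \<open>The left side is the geometric mean of \<open>?s / real (k+1)\<close> and
    \<open>1 / ?s\<close>. Passing to the arithmetic mean leaves only 1/(k+1) and a constant, whose
    sums against \<open>w\<close> are under control.\<close>
  have amgm: "1 / sqrt (real (k+1)) \<le> ?s / real (k+1) / 2 + 1 / ?s / 2" for k
  proof -
    define t where "t = sqrt (real (k+1))"
    have t: "t > 0" "t * t = real (k+1)" by (simp_all add: t_def)
    have "0 \<le> (?s - t)\<^sup>2 / (2 * t * t * ?s)" using t s by simp
    also have "\<dots> = ?s / (t*t) / 2 + 1 / ?s / 2 - 1 / t"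
      using t(1) s by (simp add: field_simps power2_eq_square del: real_sqrt_mult_self)
    finally show ?thesis unfolding t(2) by (simp add: t_def)
  qed
  have "real (n choose j) * c ^ j
      = (\<Sum>k\<le>n. real (n choose k) * real (k choose j) * c ^ k * d ^ (n - k))"
    using binomial_thinning[OF True, of c d] by (simp add: d_def)
  also have "\<dots> \<le> (\<Sum>k\<le>n. w k * (1 / sqrt (real (k+1))))"
  proof (intro sum_mono)
    fix k
    have "real (n choose k) * real (k choose j) * c ^ k * d ^ (n - k)
        = (real (n choose k) * c ^ k * d ^ (n - k)) * real (k choose j)" by simp
    also have "\<dots> \<le> (real (n choose k) * c ^ k * d ^ (n - k)) * (2 ^ k / sqrt (real (k+1)))"
      using c d by (intro mult_left_mono binomial_le_two_power) simp
    also have "\<dots> = w k * (1 / sqrt (real (k+1)))"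
      by (simp add: w_def power_mult_distrib)
    finally show "real (n choose k) * real (k choose j) * c ^ k * d ^ (n - k)
        \<le> w k * (1 / sqrt (real (k+1)))" .
  qed
  also have "\<dots> \<le> (\<Sum>k\<le>n. w k * (?s / real (k+1) / 2 + 1 / ?s / 2))"
    by (intro sum_mono mult_left_mono amgm w0)
  also have "\<dots> = (?s / 2) * (\<Sum>k\<le>n. w k / real (k+1)) + 1 / (2 * ?s) * (\<Sum>k\<le>n. w k)"
    unfolding sum_distrib_left sum.distrib[symmetric]
    by (intro sum.cong refl) (simp add: algebra_simps)
  also have "(\<Sum>k\<le>n. w k) = gold ^ n"
    unfolding w_def cd[symmetric] binomial_ring by simp
  also have "(?s / 2) * (\<Sum>k\<le>n. w k / real (k+1)) \<le> (?s / 2) * (gold ^ (n+1) / (2 * c * real (n+1)))"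
    using sum_binomial_divide_Suc_le[of "2*c" d n] c d
    by (intro mult_left_mono) (simp_all add: w_def cd)
  also have "\<dots> = gold ^ n / ?s * (gold\<^sup>2 / 4)"
  proof -
    have "(?s / 2) * (gold ^ (n+1) / (2 * c * (?s * ?s))) = gold ^ n / ?s * (gold\<^sup>2 / 4)"
      unfolding c_def using s
      by (simp add: field_simps power2_eq_square del: real_sqrt_mult_self)
    then show ?thesis unfolding ss .
  qed
  finally have "real (n choose j) * c ^ j \<le> gold ^ n / ?s * (gold\<^sup>2 / 4 + 1 / 2)"
    by (simp add: algebra_simps)
  also have "\<dots> \<le> gold ^ n / ?s * 2"
    using gold_sq_le by (intro mult_left_mono) simp_all
  finally have "real (n choose j) * c ^ j * gold ^ j \<le> gold ^ n / ?s * 2 * gold ^ j"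
    by (rule mult_right_mono) simp
  moreover have "c ^ j * gold ^ j = 1" by (simp add: c_def power_one_over)
  ultimately have "real (n choose j) \<le> gold ^ n / ?s * 2 * gold ^ j"
    by (simp only: mult.assoc mult_1_right)
  then show ?thesis by (simp add: power_add mult_ac)
qed

section \<open>Counting disjoint vectors by weight\<close>

definition weight :: "nat \<Rightarrow> (nat \<Rightarrow> nat) \<Rightarrow> nat" where
  "weight m u = card (supp m u)"

definition disj_nbrs :: "nat \<Rightarrow> (nat \<Rightarrow> nat) \<Rightarrow> (nat \<Rightarrow> nat) set" where
  "disj_nbrs m u = {v \<in> cube m. supp m u \<inter> supp m v = {}}"

lemma finite_cube [simp]: "finite (cube m)"
  by (simp add: cube_def finite_PiE)

lemma finite_disj_nbrs [simp]: "finite (disj_nbrs m u)"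
  by (simp add: disj_nbrs_def)

lemma supp_subset: "supp m u \<subseteq> {..<m}"
  by (auto simp: supp_def)

lemma finite_supp [simp]: "finite (supp m u)"
  using supp_subset by (rule finite_subset) simp

lemma weight_le: "weight m u \<le> m"
  using card_mono[OF _ supp_subset[of m u]] by (simp add: weight_def)

lemma bij_betw_supp: "bij_betw (supp m) (cube m) (Pow {..<m})"
proof (rule bij_betw_byWitness[where f' = "\<lambda>X. \<lambda>k\<in>{..<m}. if k \<in> X then 1 else 0"])
  show "\<forall>u\<in>cube m. (\<lambda>k\<in>{..<m}. if k \<in> supp m u then 1 else 0) = u"
  proof (intro ballI ext)
    fix u k assume "u \<in> cube m"
    then have "k < m \<Longrightarrow> u k = 0 \<or> u k = 1" "\<not> k < m \<Longrightarrow> u k = undefined"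
      by (auto simp: cube_def PiE_iff extensional_def)
    then show "(\<lambda>k\<in>{..<m}. if k \<in> supp m u then 1 else 0) k = u k"
      by (auto simp: supp_def)
  qed
qed (auto simp: supp_def cube_def split: if_splits)

lemma bij_betw_supp_disj_nbrs:
  "bij_betw (supp m) (disj_nbrs m u) (Pow ({..<m} - supp m u))"
proof -
  have "supp m ` disj_nbrs m u = Pow ({..<m} - supp m u)"
  proof
    show "Pow ({..<m} - supp m u) \<subseteq> supp m ` disj_nbrs m u"
    proof
      fix X assume X: "X \<in> Pow ({..<m} - supp m u)"
      then have "X \<in> supp m ` cube m"
        using bij_betw_supp[of m] by (auto simp: bij_betw_def)
      then show "X \<in> supp m ` disj_nbrs m u" using X by (auto simp: disj_nbrs_def)
    qed
  qed (use supp_subset in \<open>fastforce simp: disj_nbrs_def\<close>)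
  moreover have "inj_on (supp m) (disj_nbrs m u)"
    using bij_betw_supp[of m] by (auto simp: bij_betw_def disj_nbrs_def intro: inj_on_subset)
  ultimately show ?thesis by (simp add: bij_betw_def)
qed

lemma sum_Pow_card:
  fixes g :: "nat \<Rightarrow> real"
  assumes "finite F"
  shows "(\<Sum>X\<in>Pow F. g (card X)) = (\<Sum>j\<le>card F. real (card F choose j) * g j)"
proof -
  have "(\<Sum>X\<in>Pow F. g (card X)) = (\<Sum>j\<le>card F. \<Sum>X\<in>{X \<in> Pow F. card X = j}. g (card X))"
    using assms by (intro sum.group[symmetric]) (auto intro: card_mono)
  also have "\<dots> = (\<Sum>j\<le>card F. real (card F choose j) * g j)"
    using n_subsets[OF assms] by (intro sum.cong refl) simp
  finally show ?thesis .
qed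

text \<open>Through supports, the neighbours of \<open>u\<close> are the subsets of the complement
  of its support. Different choices of \<open>g\<close> give the degree, the eigenvector equation
  and the count below a weight threshold.\<close>

lemma sum_disj_nbrs_weight:
  fixes g :: "nat \<Rightarrow> real"
  shows "(\<Sum>v\<in>disj_nbrs m u. g (weight m v))
      = (\<Sum>j\<le>m - weight m u. real ((m - weight m u) choose j) * g j)"
proof -
  have "card ({..<m} - supp m u) = m - weight m u"
    using supp_subset by (simp add: card_Diff_subset weight_def)
  then show ?thesis
    using sum.reindex_bij_betw[OF bij_betw_supp_disj_nbrs[of m u], of "\<lambda>X. g (card X)"]
      sum_Pow_card[of "{..<m} - supp m u" g]
    by (simp add: weight_def)
qed

lemma card_disj_nbrs: "real (card (disj_nbrs m u)) = 2 ^ (m - weight m u)"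
  using sum_disj_nbrs_weight[of "\<lambda>_. 1" m u]
  by (simp flip: of_nat_sum add: choose_row_sum)

lemma card_cube: "real (card (cube m)) = 2 ^ m"
  using bij_betw_same_card[OF bij_betw_supp[of m]] by (simp add: card_Pow)

text \<open>This is the eigenvector equation at \<open>u\<close>, as the right side equals
  \<open>gold ^ m\<close> times the entry 1/\<open>gold ^ weight m u\<close>; it rests on 1 +
  1/\<open>gold\<close> = \<open>gold\<close>.\<close>

lemma sum_disj_nbrs_gold:
  "(\<Sum>v\<in>disj_nbrs m u. 1 / gold ^ weight m v) = gold ^ (m - weight m u)"
proof -
  have "(\<Sum>v\<in>disj_nbrs m u. 1 / gold ^ weight m v) = (1 / gold + 1) ^ (m - weight m u)"
    unfolding sum_disj_nbrs_weight[of "\<lambda>j. 1 / gold ^ j"] binomial_ring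
    by (simp add: power_one_over)
  then show ?thesis by (simp add: inverse_gold)
qed

text \<open>Weight j contributes C(n,j) \<le> 2 \<open>gold ^ (n + j)\<close> / sqrt(n+1)
  neighbours, and the admissible \<open>gold ^ j\<close> sum to at most
  \<open>gold\<^sup>2 * y\<close>. The weight hypothesis keeps n = m - |u| of order m, so that the
  saving is of order sqrt m.\<close>

lemma card_disj_nbrs_below_le:
  assumes "y \<ge> 0" "3 * weight m u \<le> 2 * m" "m \<ge> 1"
  shows "real (card {v \<in> disj_nbrs m u. gold ^ weight m v \<le> y})
    \<le> 12 * gold ^ m / sqrt (real m) * (y / gold ^ weight m u)"
proof -
  define n where "n = m - weight m u"
  have gn: "gold ^ n = gold ^ m / gold ^ weight m u"
    using weight_le[of m u] by (simp add: n_def power_diff)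
  have "real (card {v \<in> disj_nbrs m u. gold ^ weight m v \<le> y})
      = (\<Sum>v\<in>disj_nbrs m u. if gold ^ weight m v \<le> y then 1 else 0)"
    by (simp add: sum.If_cases Int_def)
  also have "\<dots> = (\<Sum>j\<le>n. real (n choose j) * (if gold ^ j \<le> y then 1 else 0))"
    unfolding n_def by (rule sum_disj_nbrs_weight)
  also have "\<dots> \<le> (\<Sum>j\<le>n. 2 * gold ^ n / sqrt (real (n+1)) * (if gold ^ j \<le> y then gold ^ j else 0))"
    using binomial_le_gold_power[of n] by (intro sum_mono) (simp add: power_add mult.assoc)
  also have "\<dots> \<le> 2 * gold ^ n / sqrt (real (n+1)) * (gold\<^sup>2 * y)"
    unfolding sum_distrib_left[symmetric]
    by (intro mult_left_mono sum_gold_powers_below_le assms) simp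
  also have "\<dots> \<le> 2 * gold ^ n * (2 / sqrt (real m)) * (3 * y)"
  proof (intro mult_mono)
    have "n + weight m u = m" using weight_le[of m u] by (simp add: n_def)
    \<comment> \<open>From 3|u| \<le> 2m follows m \<le> 3n. The factor 4 is chosen because its
      square root is 2; the final constant is 12 = 2 * 2 * 3.\<close>
    then have "m \<le> 4 * (n+1)" using assms(2) by presburger
    then have "real m \<le> real (4 * (n+1))" by (simp only: of_nat_le_iff)
    then have "sqrt (real m) \<le> sqrt (4 * real (n+1))" by (intro real_sqrt_le_mono) simp
    also have "\<dots> = 2 * sqrt (real (n+1))" unfolding real_sqrt_mult by simp
    finally have "1 / sqrt (real (n+1)) \<le> 2 / sqrt (real m)"
      using assms by (simp add: field_simps)
    then show "2 * gold ^ n / sqrt (real (n+1)) \<le> 2 * gold ^ n * (2 / sqrt (real m))"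
      using mult_left_mono[of "1 / sqrt (real (n+1))" "2 / sqrt (real m)" "2 * gold ^ n"] by simp
  qed (use gold_sq_le assms in auto)
  also have "\<dots> = 12 * gold ^ m / sqrt (real m) * (y / gold ^ weight m u)"
    by (simp add: gn mult_ac)
  finally show ?thesis .
qed

section \<open>Vectors of large weight: an exponential saving\<close>

text \<open>After cubing, it compares exponents of 2: 3(2m - k) \<le> 4m. The product is the trivial
  column bound times the degree of a vector of weight k.\<close>

lemma two_power_large_weight_le:
  assumes "2 * m \<le> 3 * k" "k \<le> m"
  shows "(2::real) ^ m * 2 ^ (m - k) \<le> root 3 4 ^ (2 * m)"
proof -
  have "((2::real) ^ m * 2 ^ (m - k)) ^ 3 = 2 ^ (3 * (m + (m - k)))"
    by (simp flip: power_add power_mult add: mult.commute)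
  also have "\<dots> \<le> 2 ^ (2 * (2 * m))" using assms by (intro power_increasing) auto
  also have "\<dots> = (root 3 4 ^ 3) ^ (2 * m)" by (simp add: power_mult real_root_pow_pos2)
  also have "\<dots> = (root 3 4 ^ (2 * m)) ^ 3" by (simp only: power_mult[symmetric] mult.commute)
  finally show ?thesis by (subst (asm) power_mono_iff) simp_all
qed

lemma root_3_4_less_gold: "root 3 4 < gold"
proof -
  have "gold ^ 3 = 2 * gold + 1"
    using gold_sq by (simp add: power3_eq_cube power2_eq_square algebra_simps)
  then have "4 < gold ^ 3" using gold_bounds by simp
  then have "root 3 4 < root 3 (gold ^ 3)" by simp
  then show ?thesis by (simp add: real_root_power_cancel)
qed

text \<open>The ratio of \<open>root 3 4\<close> to \<open>gold\<close> is below 1, so its m-th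
  power decays faster than 1/m, hence faster than 1/sqrt m.\<close>

lemma root_3_4_power_le:
  obtains K :: real where "K \<ge> 1"
    "\<And>m. m \<ge> 1 \<Longrightarrow> root 3 4 ^ m \<le> K * gold ^ m / sqrt (real m)"
proof -
  define q where "q = root 3 4 / gold"
  have q: "0 \<le> q" "q < 1" using root_3_4_less_gold by (simp_all add: q_def)
  then have "(\<lambda>n. real n * q ^ n) \<longlonglongrightarrow> 0" using powser_times_n_limit_0[of q] by simp
  then have "Bseq (\<lambda>n. real n * q ^ n)" by (intro convergent_imp_Bseq convergentI)
  then obtain K where K: "\<And>n. norm (real n * q ^ n) \<le> K" by (auto simp: Bseq_def)
  show ?thesis
  \<comment> \<open>Raising the constant to at least 1 later allows \<open>K\<close> to be replaced
    by its square.\<close>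
  proof (rule that[of "max K 1"])
    fix m :: nat assume m: "m \<ge> 1"
    have "sqrt (real m) \<le> real m" using m by (intro real_le_lsqrt) (simp_all add: power2_eq_square)
    then have "sqrt (real m) * q ^ m \<le> real m * q ^ m" using q by (intro mult_right_mono) auto
    also have "\<dots> \<le> max K 1" using K[of m] by simp
    finally have "sqrt (real m) * q ^ m * gold ^ m \<le> max K 1 * gold ^ m"
      by (rule mult_right_mono) simp
    then show "root 3 4 ^ m \<le> max K 1 * gold ^ m / sqrt (real m)"
      using m by (simp add: q_def power_divide field_simps)
  qed simp
qed

section \<open>Zero-one vectors and the operator norm\<close>

lemma euclid_norm_01:
  assumes "finite I" "\<xi> \<in> nonzero_01_vecs I"
  shows "euclid_norm I \<xi> = sqrt (real (card {i \<in> I. \<xi> i \<noteq> 0}))"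
proof -
  have "(\<Sum>i\<in>I. (norm (\<xi> i))\<^sup>2) = (\<Sum>i\<in>I. if \<xi> i \<noteq> 0 then 1 else 0)"
    using assms by (intro sum.cong refl) (auto simp: nonzero_01_vecs_def PiE_iff)
  also have "\<dots> = real (card {i \<in> I. \<xi> i \<noteq> 0})" using assms by (simp add: sum.If_cases Int_def)
  finally show ?thesis by (simp add: euclid_norm_def L2_set_def)
qed

lemma mat_vec_disj_mat_01:
  assumes "\<xi> \<in> nonzero_01_vecs (cube m)"
  shows "mat_vec (cube m) (disj_mat m) \<xi> u
    = of_nat (card ({i \<in> cube m. \<xi> i \<noteq> 0} \<inter> disj_nbrs m u))"
proof -
  have "mat_vec (cube m) (disj_mat m) \<xi> u
     = (\<Sum>v\<in>cube m. if v \<in> {i \<in> cube m. \<xi> i \<noteq> 0} \<inter> disj_nbrs m u then 1 else 0)"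
    unfolding mat_vec_def using assms
    by (intro sum.cong refl) (auto simp: disj_mat_def disj_nbrs_def nonzero_01_vecs_def PiE_iff)
  also have "\<dots> = of_nat (card (cube m \<inter> ({i \<in> cube m. \<xi> i \<noteq> 0} \<inter> disj_nbrs m u)))"
    by (simp add: sum.If_cases Int_def)
  finally show ?thesis by (simp add: Int_def conj_ac cong: conj_cong)
qed

lemma finite_nonzero_01_vecs: "finite I \<Longrightarrow> finite (nonzero_01_vecs I)"
  unfolding nonzero_01_vecs_def by (rule finite_subset[of _ "I \<rightarrow>\<^sub>E {0,1}"]) (auto intro: finite_PiE)

lemma nonzero_01_vecs_nonempty: "I \<noteq> {} \<Longrightarrow> nonzero_01_vecs I \<noteq> {}"
proof -
  assume "I \<noteq> {}"
  then have "(\<lambda>i\<in>I. 1) \<in> nonzero_01_vecs I" by (auto simp: nonzero_01_vecs_def)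
  then show ?thesis by blast
qed

lemma cube_nonempty: "cube m \<noteq> {}"
  by (simp add: cube_def PiE_eq_empty_iff)

section \<open>Lower bound for the operator norm\<close>

text \<open>A crude bound by the sum of all entries; it shows that the quotients in
  \<open>op_norm\<close> are bounded above, so that their supremum dominates each of them.\<close>

lemma euclid_norm_mat_vec_le:
  assumes "finite I"
  shows "euclid_norm I (mat_vec I A x) \<le> (\<Sum>i\<in>I. \<Sum>j\<in>I. norm (A i j)) * euclid_norm I x"
proof -
  have "euclid_norm I (mat_vec I A x) \<le> (\<Sum>i\<in>I. norm (mat_vec I A x i))"
    unfolding euclid_norm_def by (rule L2_set_le_sum) simp
  also have "\<dots> \<le> (\<Sum>i\<in>I. \<Sum>j\<in>I. norm (A i j) * euclid_norm I x)"
  proof (intro sum_mono)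
    fix i assume "i \<in> I"
    have "norm (mat_vec I A x i) \<le> (\<Sum>j\<in>I. norm (A i j) * norm (x j))"
      unfolding mat_vec_def by (rule order_trans[OF norm_sum]) (simp add: norm_mult)
    also have "\<dots> \<le> (\<Sum>j\<in>I. norm (A i j) * euclid_norm I x)"
      unfolding euclid_norm_def using assms
      by (intro sum_mono mult_left_mono member_le_L2_set) auto
    finally show "norm (mat_vec I A x i) \<le> (\<Sum>j\<in>I. norm (A i j) * euclid_norm I x)" .
  qed
  finally show ?thesis by (simp add: sum_distrib_right)
qed

lemma euclid_norm_pos:
  assumes "finite I" "i \<in> I" "x i \<noteq> 0"
  shows "euclid_norm I x > 0"
  using member_le_L2_set[OF assms(1,2), of "\<lambda>i. norm (x i)"] assms(3)
  by (auto simp: euclid_norm_def intro: less_le_trans[of 0 "norm (x i)"])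

lemma euclid_norm_mat_vec_le_op_norm:
  assumes "finite I" "i \<in> I" "x i \<noteq> 0"
  shows "euclid_norm I (mat_vec I A x) / euclid_norm I x \<le> op_norm I A"
  unfolding op_norm_def
proof (rule cSUP_upper)
  show "bdd_above ((\<lambda>x. euclid_norm I (mat_vec I A x) / euclid_norm I x) ` {x. \<exists>i\<in>I. x i \<noteq> 0})"
  proof (rule bdd_aboveI2)
    fix x :: "'a \<Rightarrow> complex" assume "x \<in> {x. \<exists>i\<in>I. x i \<noteq> 0}"
    then have "euclid_norm I x > 0" by (auto intro: euclid_norm_pos[OF assms(1)])
    then show "euclid_norm I (mat_vec I A x) / euclid_norm I x \<le> (\<Sum>i\<in>I. \<Sum>j\<in>I. norm (A i j))"
      using euclid_norm_mat_vec_le[OF assms(1), of A x] by (simp add: pos_divide_le_eq)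
  qed
qed (use assms in auto)

text \<open>The quotient at the positive eigenvector is its eigenvalue. Both norm bounds can
  therefore be proved with \<open>gold ^ m\<close> in place of the operator norm.\<close>

lemma gold_power_le_op_norm: "gold ^ m \<le> op_norm (cube m) (disj_mat m)"
proof -
  define x :: "(nat \<Rightarrow> nat) \<Rightarrow> complex" where "x u = of_real (1 / gold ^ weight m u)" for u
  have "mat_vec (cube m) (disj_mat m) x u = of_real (gold ^ m) * x u" for u
  proof -
    have "mat_vec (cube m) (disj_mat m) x u = (\<Sum>v\<in>cube m. if v \<in> disj_nbrs m u then x v else 0)"
      unfolding mat_vec_def by (intro sum.cong refl) (auto simp: disj_mat_def disj_nbrs_def)
    also have "\<dots> = (\<Sum>v\<in>disj_nbrs m u. x v)"
      by (simp add: sum.If_cases disj_nbrs_def Int_def)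
    also have "\<dots> = of_real (\<Sum>v\<in>disj_nbrs m u. 1 / gold ^ weight m v)"
      unfolding x_def by (rule of_real_sum[symmetric])
    also have "\<dots> = of_real (gold ^ m) * x u"
      unfolding sum_disj_nbrs_gold x_def
      using weight_le[of m u] by (simp add: power_diff)
    finally show ?thesis .
  qed
  then have "euclid_norm (cube m) (mat_vec (cube m) (disj_mat m) x) = gold ^ m * euclid_norm (cube m) x"
    by (simp add: euclid_norm_def norm_mult norm_power L2_set_right_distrib)
  moreover obtain u where u: "u \<in> cube m" using cube_nonempty by auto
  moreover have "x u \<noteq> 0" by (simp add: x_def)
  ultimately show ?thesis
    using euclid_norm_mat_vec_le_op_norm[OF finite_cube, of u m x "disj_mat m"]
      euclid_norm_pos[OF finite_cube, of u m x] by simp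
qed

section \<open>Bounds for sums over pairs of vectors\<close>

lemma disj_nbrs_commute: "\<lbrakk>u \<in> cube m; v \<in> cube m\<rbrakk> \<Longrightarrow> v \<in> disj_nbrs m u \<longleftrightarrow> u \<in> disj_nbrs m v"
  by (auto simp: disj_nbrs_def)

lemma card_disj_nbrs_large_weight_le:
  assumes "2 * m \<le> 3 * weight m u"
  shows "2 ^ m * real (card (disj_nbrs m u)) \<le> root 3 4 ^ (2 * m)"
  using two_power_large_weight_le[OF assms weight_le] by (simp add: card_disj_nbrs)

text \<open>The charging scheme in general form: a pair is charged to its first member if
  \<open>Q\<close> holds and to its second otherwise, with \<open>R\<close> and \<open>R'\<close>
  bounding the charge on one vertex.\<close>

lemma double_sum_split_le:
  fixes c :: "'a \<Rightarrow> 'b \<Rightarrow> real"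
  assumes "\<And>u. u \<in> S \<Longrightarrow> (\<Sum>v\<in>T. if Q u v then c u v else 0) \<le> R"
    and "\<And>v. v \<in> T \<Longrightarrow> (\<Sum>u\<in>S. if Q u v then 0 else c u v) \<le> R'"
  shows "(\<Sum>u\<in>S. \<Sum>v\<in>T. c u v) \<le> real (card S) * R + real (card T) * R'"
proof -
  have "(\<Sum>u\<in>S. \<Sum>v\<in>T. c u v)
     = (\<Sum>u\<in>S. \<Sum>v\<in>T. if Q u v then c u v else 0) + (\<Sum>u\<in>S. \<Sum>v\<in>T. if Q u v then 0 else c u v)"
    unfolding sum.distrib[symmetric] by (intro sum.cong refl) auto
  also have "(\<Sum>u\<in>S. \<Sum>v\<in>T. if Q u v then 0 else c u v) = (\<Sum>v\<in>T. \<Sum>u\<in>S. if Q u v then 0 else c u v)"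
    by (rule sum.swap)
  also have "(\<Sum>u\<in>S. \<Sum>v\<in>T. if Q u v then c u v else 0) \<le> real (card S) * R"
    using assms(1) by (rule sum_bounded_above)
  also have "(\<Sum>v\<in>T. \<Sum>u\<in>S. if Q u v then 0 else c u v) \<le> real (card T) * R'"
    using assms(2) by (rule sum_bounded_above)
  finally show ?thesis by simp
qed

section \<open>Edges between two sets of vectors\<close>

text \<open>The bilinear form of A_m at the indicators of \<open>S\<close> and \<open>T\<close>,
  kept as a real double sum so that the charging lemma applies directly.\<close>

definition edges :: "nat \<Rightarrow> (nat \<Rightarrow> nat) set \<Rightarrow> (nat \<Rightarrow> nat) set \<Rightarrow> real" where
  "edges m S T = (\<Sum>u\<in>S. \<Sum>v\<in>T. of_bool (v \<in> disj_nbrs m u))"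

lemma edges_commute:
  assumes "S \<subseteq> cube m" "T \<subseteq> cube m"
  shows "edges m S T = edges m T S"
proof -
  have "edges m S T = (\<Sum>v\<in>T. \<Sum>u\<in>S. of_bool (v \<in> disj_nbrs m u))"
    unfolding edges_def by (rule sum.swap)
  also have "\<dots> = edges m T S"
    unfolding edges_def
  proof (intro sum.cong refl)
    fix v u assume "v \<in> T" "u \<in> S"
    then have "v \<in> disj_nbrs m u \<longleftrightarrow> u \<in> disj_nbrs m v"
      using assms by (intro disj_nbrs_commute) auto
    then show "(of_bool (v \<in> disj_nbrs m u) :: real) = of_bool (u \<in> disj_nbrs m v)" by simp
  qed
  finally show ?thesis .
qed

lemma edges_nonneg: "edges m S T \<ge> 0"
  unfolding edges_def by (intro sum_nonneg) simp

lemma sum_of_bool_le_card: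
  assumes "finite B" "finite A" "\<And>x. \<lbrakk>x \<in> A; P x\<rbrakk> \<Longrightarrow> x \<in> B"
  shows "(\<Sum>x\<in>A. of_bool (P x) :: real) \<le> real (card B)"
proof -
  have "(\<Sum>x\<in>A. of_bool (P x) :: real) = real (card (A \<inter> {x. P x}))"
    using assms by (simp add: sum_of_bool_eq)
  also have "\<dots> \<le> real (card B)" using assms by (intro of_nat_mono card_mono) auto
  finally show ?thesis .
qed

text \<open>An edge \<open>uv\<close> is charged to \<open>u\<close> or to \<open>v\<close> according to how the difference of the two weights
  compares with the logarithm of \<open>\<tau>\<close> in base \<open>gold\<close>; the choice of \<open>\<tau>\<close> balances the two contributions.\<close>

lemma edges_small_weight_le:
  assumes "S \<subseteq> cube m" "T \<subseteq> cube m" "m \<ge> 1"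
    and S: "\<And>u. u \<in> S \<Longrightarrow> 3 * weight m u \<le> 2 * m"
    and T: "\<And>v. v \<in> T \<Longrightarrow> 3 * weight m v \<le> 2 * m"
  shows "edges m S T \<le> 24 * gold ^ m / sqrt (real m) * sqrt (real (card S) * real (card T))"
proof (cases "S = {} \<or> T = {}")
  case True
  then show ?thesis by (auto simp: edges_def)
next
  case False
  have fin: "finite S" "finite T" using assms(1,2) finite_cube finite_subset by blast+
  define s t where "s = sqrt (real (card S))" and "t = sqrt (real (card T))"
  have st: "s > 0" "t > 0" "s * s = real (card S)" "t * t = real (card T)"
    using False fin by (auto simp: s_def t_def card_gt_0_iff)
  define R where "R = 12 * gold ^ m / sqrt (real m)"
  define \<tau> where "\<tau> = t / s"
  have \<tau>: "\<tau> > 0" using st by (simp add: \<tau>_def)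
  have row: "(\<Sum>v\<in>T. if gold ^ weight m v \<le> gold ^ weight m u * \<tau> then of_bool (v \<in> disj_nbrs m u) else 0)
    \<le> R * \<tau>" if "u \<in> S" for u
  proof -
    have "(\<Sum>v\<in>T. if gold ^ weight m v \<le> gold ^ weight m u * \<tau> then of_bool (v \<in> disj_nbrs m u) else (0::real))
      = (\<Sum>v\<in>T. of_bool (v \<in> disj_nbrs m u \<and> gold ^ weight m v \<le> gold ^ weight m u * \<tau>))"
      by (intro sum.cong refl) auto
    also have "\<dots> \<le> real (card {v \<in> disj_nbrs m u. gold ^ weight m v \<le> gold ^ weight m u * \<tau>})"
      using fin by (intro sum_of_bool_le_card) auto
    also have "\<dots> \<le> R * (gold ^ weight m u * \<tau> / gold ^ weight m u)"
      unfolding R_def using \<tau> S[OF that] assms(3) by (intro card_disj_nbrs_below_le) auto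
    finally show ?thesis by simp
  qed
  have col: "(\<Sum>u\<in>S. if gold ^ weight m v \<le> gold ^ weight m u * \<tau> then 0 else of_bool (v \<in> disj_nbrs m u))
    \<le> R * (1 / \<tau>)" if "v \<in> T" for v
  proof -
    have "(\<Sum>u\<in>S. if gold ^ weight m v \<le> gold ^ weight m u * \<tau> then (0::real) else of_bool (v \<in> disj_nbrs m u))
      = (\<Sum>u\<in>S. of_bool (v \<in> disj_nbrs m u \<and> \<not> gold ^ weight m v \<le> gold ^ weight m u * \<tau>))"
      by (intro sum.cong refl) auto
    \<comment> \<open>Seen from \<open>v\<close>, the failed test says that
      \<open>gold ^ weight m u\<close> lies below \<open>gold ^ weight m v / \<tau>\<close>: the
      same counting problem with 1/\<tau> in place of \<tau>.\<close>
    also have "\<dots> \<le> real (card {u \<in> disj_nbrs m v. gold ^ weight m u \<le> gold ^ weight m v / \<tau>})"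
    proof (intro sum_of_bool_le_card fin)
      fix u assume "u \<in> S" "v \<in> disj_nbrs m u \<and> \<not> gold ^ weight m v \<le> gold ^ weight m u * \<tau>"
      then show "u \<in> {u \<in> disj_nbrs m v. gold ^ weight m u \<le> gold ^ weight m v / \<tau>}"
        using disj_nbrs_commute[of u m v] assms(1,2) that \<tau> by (auto simp: pos_le_divide_eq)
    qed simp
    also have "\<dots> \<le> R * (gold ^ weight m v / \<tau> / gold ^ weight m v)"
      unfolding R_def using \<tau> T[OF that] assms(3) by (intro card_disj_nbrs_below_le) auto
    finally show ?thesis by simp
  qed
  have "edges m S T \<le> real (card S) * (R * \<tau>) + real (card T) * (R * (1 / \<tau>))"
    unfolding edges_def using row col by (rule double_sum_split_le)
  \<comment> \<open>Balance: |S| \<tau> and |T| / \<tau> both equal s t.\<close>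
  also have "\<dots> = 2 * R * (s * t)"
    unfolding \<tau>_def st(3,4)[symmetric] using st(1,2) by (simp add: field_simps)
  finally show ?thesis by (simp add: R_def s_def t_def real_sqrt_mult)
qed

text \<open>Rows are bounded by the small degree and columns by the size of the cube. The edge count
  is below both resulting totals, hence below their geometric mean, in which the powers of 2
  cancel.\<close>

lemma edges_large_weight_le:
  assumes "S \<subseteq> cube m" "T \<subseteq> cube m"
    and S: "\<And>u. u \<in> S \<Longrightarrow> 2 * m \<le> 3 * weight m u"
  shows "edges m S T \<le> root 3 4 ^ m * sqrt (real (card S) * real (card T))"
proof -
  have fin: "finite S" "finite T" using assms(1,2) finite_cube finite_subset by blast+
  have row: "(\<Sum>v\<in>T. of_bool (v \<in> disj_nbrs m u)) \<le> root 3 4 ^ (2 * m) / 2 ^ m" if "u \<in> S" for u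
  proof -
    have "(\<Sum>v\<in>T. of_bool (v \<in> disj_nbrs m u) :: real) \<le> real (card (disj_nbrs m u))"
      using fin by (intro sum_of_bool_le_card) auto
    also have "\<dots> \<le> root 3 4 ^ (2 * m) / 2 ^ m"
      using card_disj_nbrs_large_weight_le[OF S[OF that]] by (simp add: field_simps)
    finally show ?thesis .
  qed
  have col: "(\<Sum>u\<in>S. of_bool (v \<in> disj_nbrs m u)) \<le> (2::real) ^ m" for v
    unfolding card_cube[symmetric] using fin assms(1) by (intro sum_of_bool_le_card) auto
  have 1: "edges m S T \<le> real (card S) * (root 3 4 ^ (2 * m) / 2 ^ m)"
    unfolding edges_def using row by (rule sum_bounded_above)
  have 2: "edges m S T \<le> real (card T) * 2 ^ m"
    unfolding edges_def sum.swap[of _ T] using col by (rule sum_bounded_above)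
  have "(edges m S T)\<^sup>2 \<le> (real (card S) * (root 3 4 ^ (2 * m) / 2 ^ m)) * (real (card T) * 2 ^ m)"
    unfolding power2_eq_square using 1 2 edges_nonneg by (intro mult_mono) auto
  also have "\<dots> = (root 3 4 ^ m * sqrt (real (card S) * real (card T)))\<^sup>2"
    by (simp add: power_mult_distrib power_mult[symmetric] mult.commute[of m])
  finally show ?thesis by (rule power2_le_imp_le) simp
qed

text \<open>The pairs split into S2 x T, S1 x T2 and S1 x T1, where index 1 marks small weight. The
  first two involve a large-weight side, after exchanging sides in the second, and cost
  \<open>K\<close> each; the third costs 24.\<close>

lemma edges_le:
  assumes K: "root 3 4 ^ m \<le> K * gold ^ m / sqrt (real m)"
    and S: "S \<subseteq> cube m" and T: "T \<subseteq> cube m" and m: "m \<ge> 1"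
  shows "edges m S T \<le> (24 + 2 * K) * gold ^ m / sqrt (real m) * sqrt (real (card S) * real (card T))"
proof -
  define S1 S2 where "S1 = {u \<in> S. 3 * weight m u \<le> 2 * m}" and "S2 = S - S1"
  define T1 T2 where "T1 = {u \<in> T. 3 * weight m u \<le> 2 * m}" and "T2 = T - T1"
  have fin: "finite S" "finite T" using S T finite_cube finite_subset by blast+
  have sub: "S1 \<subseteq> S" "S2 \<subseteq> S" "T1 \<subseteq> T" "T2 \<subseteq> T"
    by (auto simp: S1_def S2_def T1_def T2_def)
  let ?q = "sqrt (real (card S) * real (card T))"
  have mono: "sqrt (real (card X) * real (card Y)) \<le> ?q" if "X \<subseteq> S" "Y \<subseteq> T" for X Y
    using fin that by (intro real_sqrt_le_mono mult_mono of_nat_mono card_mono) auto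
  have split1: "edges m S T = edges m S2 T + edges m S1 T"
    unfolding edges_def S2_def using sum.subset_diff[OF sub(1) fin(1)] .
  have split2: "edges m S1 T = edges m S1 T2 + edges m S1 T1"
    unfolding edges_def T2_def sum.distrib[symmetric]
    by (intro sum.cong refl sum.subset_diff[OF sub(3) fin(2)])
  have "edges m S2 T \<le> root 3 4 ^ m * sqrt (real (card S2) * real (card T))"
    using S T by (intro edges_large_weight_le) (auto simp: S1_def S2_def)
  also have "\<dots> \<le> root 3 4 ^ m * ?q" by (intro mult_left_mono mono sub order_refl) simp
  finally have 1: "edges m S2 T \<le> root 3 4 ^ m * ?q" .
  have "edges m S1 T2 = edges m T2 S1"
    using S T sub by (intro edges_commute) auto
  also have "\<dots> \<le> root 3 4 ^ m * sqrt (real (card T2) * real (card S1))"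
    using S T by (intro edges_large_weight_le) (auto simp: S1_def T1_def T2_def)
  also have "\<dots> = root 3 4 ^ m * sqrt (real (card S1) * real (card T2))"
    by (simp only: mult.commute[of "real (card T2)"])
  also have "\<dots> \<le> root 3 4 ^ m * ?q" by (intro mult_left_mono mono sub) simp
  finally have 2: "edges m S1 T2 \<le> root 3 4 ^ m * ?q" .
  have "edges m S1 T1 \<le> 24 * gold ^ m / sqrt (real m) * sqrt (real (card S1) * real (card T1))"
    using S T m by (intro edges_small_weight_le) (auto simp: S1_def T1_def)
  also have "\<dots> \<le> 24 * gold ^ m / sqrt (real m) * ?q" by (intro mult_left_mono mono sub) simp
  finally have 3: "edges m S1 T1 \<le> 24 * gold ^ m / sqrt (real m) * ?q" .
  have "edges m S T \<le> (24 * gold ^ m / sqrt (real m) + 2 * root 3 4 ^ m) * ?q"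
    using 1 2 3 split1 split2 by (simp add: algebra_simps)
  also have "\<dots> \<le> (24 * gold ^ m / sqrt (real m) + 2 * (K * gold ^ m / sqrt (real m))) * ?q"
    using K by (intro mult_right_mono) auto
  also have "\<dots> = (24 + 2 * K) * gold ^ m / sqrt (real m) * ?q"
    by (simp add: add_divide_distrib algebra_simps)
  finally show ?thesis .
qed

section \<open>Common neighbours and the square of the matrix\<close>

text \<open>For vectors of the cube this is the (u,v) entry of the square of A_m, the number of
  common neighbours.\<close>

definition codegree :: "nat \<Rightarrow> (nat \<Rightarrow> nat) \<Rightarrow> (nat \<Rightarrow> nat) \<Rightarrow> real" where
  "codegree m u v = (\<Sum>w\<in>cube m. of_bool (u \<in> disj_nbrs m w) * of_bool (v \<in> disj_nbrs m w))"

lemma codegree_commute: "codegree m u v = codegree m v u"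
  by (simp add: codegree_def mult.commute)

lemma codegree_nonneg: "codegree m u v \<ge> 0"
  unfolding codegree_def by (intro sum_nonneg) simp

text \<open>It counts paths u, w, v with |v| \<le> |u|. A middle vertex w of small weight admits
  O(\<open>gold ^ m\<close> \<open>gold ^ (|u| - |w|)\<close> / sqrt m) choices of v, and the
  eigenvector equation sums \<open>gold ^ (-|w|)\<close> over the neighbours w of u to
  \<open>gold ^ (m - |u|)\<close>, so |u| cancels. Middle vertices of large weight account for the
  second term.\<close>

lemma sum_codegree_below_le:
  assumes "S \<subseteq> cube m" "u \<in> cube m" "m \<ge> 1"
  shows "(\<Sum>v\<in>S. if gold ^ weight m v \<le> gold ^ weight m u then codegree m u v else 0)
    \<le> 12 * gold ^ (2 * m) / sqrt (real m) + root 3 4 ^ (2 * m)"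
proof -
  let ?R = "12 * gold ^ m / sqrt (real m)"
  let ?B = "\<lambda>w. {v \<in> disj_nbrs m w. gold ^ weight m v \<le> gold ^ weight m u}"
  \<comment> \<open>Adding the bounds of the two cases gives one estimate valid for every
    \<open>w\<close>, which can be summed without splitting the neighbourhood.\<close>
  have B: "real (card (?B w)) \<le> ?R * gold ^ weight m u * (1 / gold ^ weight m w) + root 3 4 ^ (2 * m) / 2 ^ m" for w
  proof (cases "3 * weight m w \<le> 2 * m")
    case True
    have "real (card (?B w)) \<le> ?R * (gold ^ weight m u / gold ^ weight m w)"
      using True assms(3) by (intro card_disj_nbrs_below_le) auto
    also have "\<dots> = ?R * gold ^ weight m u * (1 / gold ^ weight m w) + 0" by simp
    also have "\<dots> \<le> ?R * gold ^ weight m u * (1 / gold ^ weight m w) + root 3 4 ^ (2 * m) / 2 ^ m"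
      by (intro add_left_mono) simp
    finally show ?thesis .
  next
    case False
    have "real (card (?B w)) \<le> real (card (disj_nbrs m w))"
      by (intro of_nat_mono card_mono) auto
    also have "\<dots> \<le> 0 + root 3 4 ^ (2 * m) / 2 ^ m"
      using card_disj_nbrs_large_weight_le[of m w] False by (simp add: field_simps)
    also have "\<dots> \<le> ?R * gold ^ weight m u * (1 / gold ^ weight m w) + root 3 4 ^ (2 * m) / 2 ^ m"
      by (intro add_right_mono) simp
    finally show ?thesis .
  qed
  have "(\<Sum>v\<in>S. if gold ^ weight m v \<le> gold ^ weight m u then codegree m u v else 0)
    \<le> (\<Sum>v\<in>cube m. if gold ^ weight m v \<le> gold ^ weight m u then codegree m u v else 0)"
    using assms(1) by (intro sum_mono2) (auto simp: codegree_nonneg)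
  also have "\<dots> = (\<Sum>v\<in>cube m. \<Sum>w\<in>cube m. of_bool (u \<in> disj_nbrs m w) * of_bool (v \<in> ?B w))"
    unfolding codegree_def by (intro sum.cong refl) auto
  also have "\<dots> = (\<Sum>w\<in>cube m. \<Sum>v\<in>cube m. of_bool (u \<in> disj_nbrs m w) * of_bool (v \<in> ?B w))"
    by (rule sum.swap)
  also have "\<dots> \<le> (\<Sum>w\<in>cube m. of_bool (u \<in> disj_nbrs m w) * real (card (?B w)))"
    unfolding sum_distrib_left[symmetric]
    by (intro sum_mono mult_left_mono sum_of_bool_le_card) auto
  also have "\<dots> = (\<Sum>w\<in>cube m. if w \<in> disj_nbrs m u then real (card (?B w)) else 0)"
  proof (intro sum.cong refl)
    fix w assume "w \<in> cube m"
    then show "of_bool (u \<in> disj_nbrs m w) * real (card (?B w))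
        = (if w \<in> disj_nbrs m u then real (card (?B w)) else 0)"
      using disj_nbrs_commute[of u m w] assms(2) by auto
  qed
  also have "\<dots> = (\<Sum>w\<in>disj_nbrs m u. real (card (?B w)))"
    by (intro sum.mono_neutral_cong_right) (auto simp: disj_nbrs_def)
  also have "\<dots> \<le> (\<Sum>w\<in>disj_nbrs m u. ?R * gold ^ weight m u * (1 / gold ^ weight m w)
      + root 3 4 ^ (2 * m) / 2 ^ m)"
    by (intro sum_mono B)
  also have "\<dots> = ?R * gold ^ weight m u * gold ^ (m - weight m u)
      + real (card (disj_nbrs m u)) * (root 3 4 ^ (2 * m) / 2 ^ m)"
    unfolding sum.distrib sum_distrib_left[symmetric] sum_disj_nbrs_gold by simp
  also have "real (card (disj_nbrs m u)) * (root 3 4 ^ (2 * m) / 2 ^ m)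
      \<le> 2 ^ m * (root 3 4 ^ (2 * m) / 2 ^ m)"
    by (intro mult_right_mono) (simp_all add: card_disj_nbrs)
  also have "?R * gold ^ weight m u * gold ^ (m - weight m u) = 12 * gold ^ (2 * m) / sqrt (real m)"
  proof -
    have "gold ^ weight m u * gold ^ (m - weight m u) = gold ^ m"
      using weight_le[of m u] by (simp flip: power_add)
    then show ?thesis by (simp add: mult_2 power_add mult.assoc)
  qed
  finally show ?thesis by simp
qed

text \<open>The left side is the squared norm of A_m applied to the indicator of \<open>S\<close>.
  Expanding the squares gives the sum of codegrees over pairs from \<open>S\<close>, and each pair
  is charged to its heavier member.\<close>

lemma sum_card_sq_le:
  assumes K: "root 3 4 ^ m \<le> K * gold ^ m / sqrt (real m)"
    and S: "S \<subseteq> cube m" and m: "m \<ge> 1"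
  shows "(\<Sum>w\<in>cube m. (real (card (S \<inter> disj_nbrs m w)))\<^sup>2)
    \<le> (24 + 2 * K\<^sup>2) * gold ^ (2 * m) / sqrt (real m) * real (card S)"
proof -
  let ?R = "12 * gold ^ (2 * m) / sqrt (real m) + root 3 4 ^ (2 * m)"
  have fin: "finite S" using S finite_cube finite_subset by blast
  have "(\<Sum>w\<in>cube m. (real (card (S \<inter> disj_nbrs m w)))\<^sup>2)
     = (\<Sum>w\<in>cube m. \<Sum>u\<in>S. \<Sum>v\<in>S. of_bool (u \<in> disj_nbrs m w) * of_bool (v \<in> disj_nbrs m w))"
  proof (intro sum.cong refl)
    fix w
    have "real (card (S \<inter> disj_nbrs m w)) = (\<Sum>u\<in>S. of_bool (u \<in> disj_nbrs m w))"
      using fin by (simp add: sum_of_bool_eq)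
    then show "(real (card (S \<inter> disj_nbrs m w)))\<^sup>2
        = (\<Sum>u\<in>S. \<Sum>v\<in>S. of_bool (u \<in> disj_nbrs m w) * of_bool (v \<in> disj_nbrs m w))"
      by (simp only: power2_eq_square sum_product)
  qed
  also have "\<dots> = (\<Sum>u\<in>S. \<Sum>v\<in>S. codegree m u v)"
    unfolding codegree_def
    by (subst sum.swap) (intro sum.cong refl sum.swap)
  also have "\<dots> \<le> real (card S) * ?R + real (card S) * ?R"
  proof (rule double_sum_split_le)
    fix u assume u: "u \<in> S"
    then show "(\<Sum>v\<in>S. if gold ^ weight m v \<le> gold ^ weight m u then codegree m u v else 0) \<le> ?R"
      using S m by (intro sum_codegree_below_le) auto
    \<comment> \<open>By symmetry of the codegree the second kind of charge is of the first kind,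
      with the strict comparison of weights relaxed.\<close>
    have "(\<Sum>v\<in>S. if gold ^ weight m u \<le> gold ^ weight m v then 0 else codegree m v u)
      \<le> (\<Sum>v\<in>S. if gold ^ weight m v \<le> gold ^ weight m u then codegree m u v else 0)"
      by (intro sum_mono) (auto simp: codegree_nonneg codegree_commute)
    also have "\<dots> \<le> ?R" using u S m by (intro sum_codegree_below_le) auto
    finally show "(\<Sum>v\<in>S. if gold ^ weight m u \<le> gold ^ weight m v then 0 else codegree m v u) \<le> ?R" .
  qed
  also have "\<dots> = 2 * ?R * real (card S)" by simp
  also have "\<dots> \<le> (24 + 2 * K\<^sup>2) * gold ^ (2 * m) / sqrt (real m) * real (card S)"
  proof (rule mult_right_mono)
    have "root 3 4 ^ (2 * m) = (root 3 4 ^ m)\<^sup>2"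
      by (simp flip: power_mult add: mult.commute)
    also have "\<dots> \<le> (K * gold ^ m / sqrt (real m))\<^sup>2" using K by (intro power_mono) auto
    also have "\<dots> = K\<^sup>2 * gold ^ (2 * m) / real m"
      by (simp add: power_divide power_mult_distrib mult.commute[of 2] power_mult)
    \<comment> \<open>Squaring the bound yields the better factor 1/m, weakened here to 1/sqrt m to
      match the main term.\<close>
    also have "\<dots> \<le> K\<^sup>2 * gold ^ (2 * m) / sqrt (real m)"
      using m by (intro divide_left_mono real_le_lsqrt) (auto simp: power2_eq_square)
    finally show "2 * ?R \<le> (24 + 2 * K\<^sup>2) * gold ^ (2 * m) / sqrt (real m)"
      by (simp add: add_divide_distrib algebra_simps)
  qed simp
  finally show ?thesis .
qed

section \<open>The two norm bounds\<close>

theorem theorem5: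
  "\<exists>C::real. C > 0 \<and> (\<forall>m::nat. m \<ge> 1 \<longrightarrow>
     Delta_norm (cube m) (disj_mat m)
       \<le> C * (op_norm (cube m) (disj_mat m) / real m powr (1/4)) \<and>
     P_norm (cube m) (disj_mat m)
       \<le> C * (op_norm (cube m) (disj_mat m) / sqrt (real m)))"
proof -
  obtain K where K1: "K \<ge> 1"
    and K: "\<And>m. m \<ge> 1 \<Longrightarrow> root 3 4 ^ m \<le> K * gold ^ m / sqrt (real m)"
    using root_3_4_power_le by blast
  \<comment> \<open>The constant of the squared Delta estimate; as \<open>K \<ge> 1\<close>, it also
    dominates the constant 24 + 2K of the P estimate.\<close>
  define C where "C = 24 + 2 * K\<^sup>2"
  have "K \<le> K\<^sup>2" using K1 by (simp add: power2_eq_square)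
  then have KC: "24 + 2 * K \<le> C" by (simp add: C_def)
  have C1: "C \<ge> 1" using KC K1 by simp
  have "Delta_norm (cube m) (disj_mat m)
       \<le> C * (op_norm (cube m) (disj_mat m) / real m powr (1/4))"
    and "P_norm (cube m) (disj_mat m)
       \<le> C * (op_norm (cube m) (disj_mat m) / sqrt (real m))" if m: "m \<ge> 1" for m
  proof -
    let ?V = "nonzero_01_vecs (cube m)" and ?op = "op_norm (cube m) (disj_mat m)"
    define s where "s \<xi> = {i \<in> cube m. \<xi> i \<noteq> 0}" for \<xi> :: "(nat \<Rightarrow> nat) \<Rightarrow> complex"
    have s_sub: "s \<xi> \<subseteq> cube m" for \<xi> by (auto simp: s_def)
    have nrm: "euclid_norm (cube m) \<xi> = sqrt (real (card (s \<xi>)))" "card (s \<xi>) > 0" if "\<xi> \<in> ?V" for \<xi>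
      using that euclid_norm_01[OF finite_cube that]
      by (auto simp: s_def card_gt_0_iff nonzero_01_vecs_def)
    have V: "finite ?V" "?V \<noteq> {}"
      by (simp_all add: finite_nonzero_01_vecs nonzero_01_vecs_nonempty cube_nonempty)
    show "Delta_norm (cube m) (disj_mat m) \<le> C * (?op / real m powr (1/4))"
      unfolding Delta_norm_def
    proof (rule Max.boundedI)
      fix r assume "r \<in> (\<lambda>\<xi>. euclid_norm (cube m) (mat_vec (cube m) (disj_mat m) \<xi>)
          / euclid_norm (cube m) \<xi>) ` ?V"
      then obtain \<xi> where \<xi>: "\<xi> \<in> ?V"
        and r: "r = euclid_norm (cube m) (mat_vec (cube m) (disj_mat m) \<xi>) / euclid_norm (cube m) \<xi>"
        by auto
      have "(euclid_norm (cube m) (mat_vec (cube m) (disj_mat m) \<xi>))\<^sup>2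
          = (\<Sum>w\<in>cube m. (real (card (s \<xi> \<inter> disj_nbrs m w)))\<^sup>2)"
        by (simp add: euclid_norm_def L2_set_def sum_nonneg mat_vec_disj_mat_01[OF \<xi>] s_def)
      also have "\<dots> \<le> C * gold ^ (2 * m) / sqrt (real m) * real (card (s \<xi>))"
        unfolding C_def by (rule sum_card_sq_le[OF K[OF m] s_sub m])
      finally have "r\<^sup>2 \<le> C * gold ^ (2 * m) / sqrt (real m)"
        using nrm[OF \<xi>] by (simp add: r power_divide pos_divide_le_eq)
      \<comment> \<open>Using \<open>C \<ge> 1\<close> to pass to the square of \<open>C\<close>
        makes the right side a perfect square; its root turns 1/sqrt m into the fourth-root
        saving.\<close>
      also have "\<dots> \<le> C\<^sup>2 * gold ^ (2 * m) / sqrt (real m)"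
        using C1 by (intro divide_right_mono mult_right_mono) (auto simp: power2_eq_square)
      also have "\<dots> = (C * (gold ^ m / real m powr (1/4)))\<^sup>2"
      proof -
        have "(real m powr (1/4))\<^sup>2 = sqrt (real m)"
          using m by (simp add: powr_power powr_half_sqrt)
        then show ?thesis
          by (simp add: power_divide power_mult_distrib mult.commute[of 2] power_mult)
      qed
      finally have "r \<le> C * (gold ^ m / real m powr (1/4))"
        by (rule power2_le_imp_le) (use C1 in simp)
      also have "\<dots> \<le> C * (?op / real m powr (1/4))"
        using C1 by (intro mult_left_mono divide_right_mono gold_power_le_op_norm) auto
      finally show "r \<le> C * (?op / real m powr (1/4))" .
    qed (use V in auto)
    show "P_norm (cube m) (disj_mat m) \<le> C * (?op / sqrt (real m))"
      unfolding P_norm_def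
    proof (rule Max.boundedI)
      fix r assume "r \<in> (\<lambda>(\<xi>, \<eta>). norm (\<Sum>i\<in>cube m. \<xi> i * mat_vec (cube m) (disj_mat m) \<eta> i)
          / (euclid_norm (cube m) \<xi> * euclid_norm (cube m) \<eta>)) ` (?V \<times> ?V)"
      then obtain \<xi> \<eta> where \<xi>: "\<xi> \<in> ?V" and \<eta>: "\<eta> \<in> ?V"
        and r: "r = norm (\<Sum>i\<in>cube m. \<xi> i * mat_vec (cube m) (disj_mat m) \<eta> i)
          / (euclid_norm (cube m) \<xi> * euclid_norm (cube m) \<eta>)"
        by auto
      \<comment> \<open>For zero-one vectors the bilinear form counts the edges between their
        supports, and the denominator is the geometric mean of the support sizes.\<close>
      have "(\<Sum>i\<in>cube m. \<xi> i * mat_vec (cube m) (disj_mat m) \<eta> i)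
          = (\<Sum>i\<in>s \<xi>. of_nat (card (s \<eta> \<inter> disj_nbrs m i)))"
        unfolding mat_vec_disj_mat_01[OF \<eta>] s_def[symmetric] using \<xi>
        by (intro sum.mono_neutral_cong_right) (auto simp: s_def nonzero_01_vecs_def PiE_iff)
      also have "\<dots> = of_real (edges m (s \<xi>) (s \<eta>))"
        using finite_subset[OF s_sub[of \<eta>] finite_cube] by (simp add: edges_def sum_of_bool_eq)
      finally have "r = edges m (s \<xi>) (s \<eta>) / sqrt (real (card (s \<xi>)) * real (card (s \<eta>)))"
        unfolding r using nrm(1)[OF \<xi>] nrm(1)[OF \<eta>] edges_nonneg[of m "s \<xi>" "s \<eta>"]
        by (simp add: real_sqrt_mult)
      also have "\<dots> \<le> (24 + 2 * K) * gold ^ m / sqrt (real m)"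
        using edges_le[OF K[OF m] s_sub[of \<xi>] s_sub[of \<eta>] m] nrm(2)[OF \<xi>] nrm(2)[OF \<eta>]
        by (simp add: pos_divide_le_eq)
      also have "\<dots> \<le> C * ?op / sqrt (real m)"
        using KC C1 gold_power_le_op_norm by (intro divide_right_mono mult_mono) auto
      finally show "r \<le> C * (?op / sqrt (real m))" by simp
    qed (use V in auto)
  qed
  then show ?thesis using C1 by (intro exI[of _ C]) auto
qed

end
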